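(* Let $E$ be a nuclear Fréchet space with the properties $\underline{DN}$ and $\Omega$ and let $\varepsilon=(\varepsilon_n)_{n\in\mathbb N}$ be the associated exponent sequence of $E$. Then $\delta(E)=\delta(\Lambda_1(\varepsilon))$ implies $\Delta(E)=\Delta(\Lambda_1(\varepsilon))$.
   Context: The topology of a nuclear Fréchet space $E$ is given by an increasing sequence of Hilbertian seminorms $(\|\cdot\|_k)_{k\in\mathbb N}$; put $U_k=\{x\in E:\|x\|_k\le 1\}$, so $U_1\supset U_2\supset\cdots$ is a base of neighborhoods of zero. Kolmogorov diameters: for absolutely convex $V,U\subseteq E$ with $V\subseteq CU$ for some $C>0$, $d_n(V,U)=\inf\{\delta(V,U,L): L\text{ a subspace of }E,\ \dim L\le n\}$, $n=0,1,\dots$, where $\delta(V,U,L)=\inf\{t>0: V\subseteq tU+L\}$. Diametral dimension: $\Delta(E)=\{(t_n)_{n\in\mathbb N}:\forall p\ \exists q>p\ \lim_{n\to\infty}t_n d_n(U_q,U_p)=0\}$. Approximate diametral dimension: $\delta(E)=\bigcup_{U}\bigcup_{B}\{(t_n)_{n\in\mathbb N}:\lim_{n\to\infty}t_n/d_n(B,U)=0\}$, with $U$ running over all neighborhoods of zero and $B$ over all bounded subsets of $E$; equivalently $\delta(E)=\{(t_n)_{n\in\mathbb N}:\exists p\ \forall q>p\ \lim_{n\to\infty}t_n/d_n(U_q,U_p)=0\}$. Equalities and inclusions of $\Delta$'s and $\delta$'s are as sets of sequences. $\underline{DN}$: there is $p\in\mathbb N$ such that for each $k>p$ there exist $n>k$,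 $0<\tau<1$, $C>0$ with $\|x\|_k\le C\|x\|_p^{1-\tau}\|x\|_n^{\tau}$ for all $x\in E$. $\Omega$: for each $p\in\mathbb N$ there is $q>p$ such that for every $k>q$ there exist $0<\theta<1$, $C>0$ with $\|y\|_q^*\le C(\|y\|_p^* )^{1-\theta}(\|y\|_k^* )^{\theta}$ for all $y\in E'$, where $\|y\|_k^*=\sup\{|y(x)|:\|x\|_k\le1\}\in\mathbb R\cup\{+\infty\}$. Power series spaces: for an exponent sequence $\alpha=(\alpha_n)$ (non-negative, increasing, $\alpha_n\to+\infty$), $\Lambda_1(\alpha)=\{(x_n):\sup_n|x_n|e^{-\alpha_n/k}<\infty\ \forall k\in\mathbb N\}$ and $\Lambda_\infty(\alpha)=\{(x_n):\sup_n|x_n|e^{k\alpha_n}<\infty\ \forall k\in\mathbb N\}$, Fréchet spaces with these seminorms. All power series spaces are assumed nuclear; in particular $\Lambda_1(\varepsilon)$ is assumed nuclear for the associated exponent sequence $\varepsilon$. Known: $\Delta(\Lambda_1(\alpha))=\Lambda_1(\alpha)$; $\Delta(\Lambda_\infty(\alpha))=\Lambda_\infty(\alpha)'=\{(x_n):\exists R>0\ \sup_n|x_n|e^{-R\alpha_n}<\infty\}$; $\delta(\Lambda_1(\alpha))=\Lambda_1(\alpha)'=\{(x_n):\exists k\ \sup_n|x_n|e^{\alpha_n/k}<\infty\}$; $\delta(\Lambda_\infty(\alpha))=\Lambda_\infty(\alpha)$. Associated exponent sequence: for a nuclear Fréchet space $E$ with $\underline{DN}$ and $\Omega$ it is the exponent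 sequence $\varepsilon$ (known to exist, unique up to equivalence) with $\Delta(\Lambda_1(\varepsilon))\subseteq\Delta(E)\subseteq\Delta(\Lambda_\infty(\varepsilon))$ such that, moreover, $\Lambda_1(\alpha)\subseteq\Delta(E)$ implies $\Lambda_1(\alpha)\subseteq\Lambda_1(\varepsilon)$, and $\Delta(E)\subseteq\Lambda_\infty(\alpha)'$ implies $\Lambda_\infty(\varepsilon)'\subseteq\Lambda_\infty(\alpha)'$. It is also known that $\delta(\Lambda_\infty(\varepsilon))\subseteq\delta(E)\subseteq\delta(\Lambda_1(\varepsilon))$. *)

theory Defs
  imports
    Complex_Main
    "HOL-Library.Function_Algebras"
    "HOL-Library.Extended_Nonnegative_Real"
begin

section \<open>Spaces with an increasing sequence of seminorms\<close>

text \<open>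
  The scalar type \<open>'k :: real_normed_field\<close> stands for the real or the complex numbers: up to
  isometric isomorphism these are the only fields of that class (Gelfand--Mazur), so both cases are
  covered at once.  A space is a linear subspace \<open>vecs E\<close> of an ambient vector space; the explicit
  subset is needed because the power series spaces depend on a sequence and so cannot be types.
  Nothing is said about \<open>snorm E k\<close> or about functionals outside \<open>vecs E\<close>.
\<close>

record ('k, 'a) seminormed_space =
  vecs :: "'a set"
  scale :: "'k \<Rightarrow> 'a \<Rightarrow> 'a"
  snorm :: "nat \<Rightarrow> 'a \<Rightarrow> real"

definition seminorm_on ::
  "('k::real_normed_field, 'a::ab_group_add) seminormed_space \<Rightarrow> ('a \<Rightarrow> real) \<Rightarrow> bool" where
  "seminorm_on E q \<longleftrightarrow>
     (\<forall>x\<in>vecs E. 0 \<le> q x) \<and>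
     (\<forall>x\<in>vecs E. \<forall>y\<in>vecs E. q (x + y) \<le> q x + q y) \<and>
     (\<forall>c. \<forall>x\<in>vecs E. q (scale E c x) = norm c * q x)"

text \<open>
  A seminorm given by a positive semidefinite inner product.  The form \<open>b\<close> is the real part of
  that product; over the complex numbers the sesquilinear form is recovered, by homogeneity of the
  seminorm \<open>q\<close>, as \<open>b x y + \<i> b x (\<i> y)\<close>.
\<close>

definition hilbertian_on ::
  "('k::real_normed_field, 'a::ab_group_add) seminormed_space \<Rightarrow> ('a \<Rightarrow> real) \<Rightarrow> bool" where
  "hilbertian_on E q \<longleftrightarrow> seminorm_on E q \<and>
     (\<exists>b. (\<forall>x\<in>vecs E. \<forall>y\<in>vecs E. b x y = b y x) \<and>
          (\<forall>x\<in>vecs E. \<forall>y\<in>vecs E. \<forall>z\<in>vecs E. b (x + y) z = b x z + b y z) \<and>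
          (\<forall>r. \<forall>x\<in>vecs E. \<forall>y\<in>vecs E. b (scale E (of_real r) x) y = r * b x y) \<and>
          (\<forall>x\<in>vecs E. (q x)\<^sup>2 = b x x))"

definition frechet_space ::
  "('k::real_normed_field, 'a::ab_group_add) seminormed_space \<Rightarrow> bool" where
  "frechet_space E \<longleftrightarrow>
     vector_space (scale E) \<and>
     module.subspace (scale E) (vecs E) \<and>
     (\<forall>k. seminorm_on E (snorm E k)) \<and>
     (\<forall>k. \<forall>x\<in>vecs E. snorm E k x \<le> snorm E (Suc k) x) \<and>
     (\<forall>x\<in>vecs E. (\<forall>k. snorm E k x = 0) \<longrightarrow> x = 0) \<and>
     (\<forall>f. (\<forall>i. f i \<in> vecs E) \<and>
          (\<forall>k. \<forall>e>0. \<exists>N. \<forall>i\<ge>N. \<forall>j\<ge>N. snorm E k (f i - f j) < e) \<longrightarrow>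
          (\<exists>x\<in>vecs E. \<forall>k. (\<lambda>i. snorm E k (f i - x)) \<longlonglongrightarrow> 0))"

definition linear_functional ::
  "('k::real_normed_field, 'a::ab_group_add) seminormed_space \<Rightarrow> ('a \<Rightarrow> 'k) \<Rightarrow> bool" where
  "linear_functional E y \<longleftrightarrow>
     (\<forall>u\<in>vecs E. \<forall>v\<in>vecs E. y (u + v) = y u + y v) \<and>
     (\<forall>c. \<forall>u\<in>vecs E. y (scale E c u) = c * y u)"

definition dual_space ::
  "('k::real_normed_field, 'a::ab_group_add) seminormed_space \<Rightarrow> ('a \<Rightarrow> 'k) set" where
  "dual_space E = {y. linear_functional E y \<and>
     (\<exists>k C. \<forall>x\<in>vecs E. norm (y x) \<le> C * snorm E k x)}"

definition unit_ball ::
  "('k::real_normed_field, 'a::ab_group_add) seminormed_space \<Rightarrow> nat \<Rightarrow> 'a set" where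
  "unit_ball E k = {x \<in> vecs E. snorm E k x \<le> 1}"

definition dual_norm ::
  "('k::real_normed_field, 'a::ab_group_add) seminormed_space \<Rightarrow> nat \<Rightarrow> ('a \<Rightarrow> 'k) \<Rightarrow> ennreal" where
  "dual_norm E k y = (SUP x\<in>unit_ball E k. ennreal (norm (y x)))"

text \<open>
  Nuclearity: for every \<open>k\<close> some linking map from the local Banach space of \<open>snorm E m\<close> to that of
  \<open>snorm E k\<close> is nuclear.  The functionals \<open>a j\<close> live on the local space of \<open>snorm E m\<close> because of
  the bound by \<open>c j\<close>.  The vectors \<open>v j\<close> are taken in \<open>E\<close> rather than in the completed local space;
  this is no restriction, as an element of the completion is the sum of an absolutely convergent
  series from the dense image of \<open>E\<close> whose norms add up to at most twice its own norm.
\<close>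

definition nuclear_space ::
  "('k::real_normed_field, 'a::ab_group_add) seminormed_space \<Rightarrow> bool" where
  "nuclear_space E \<longleftrightarrow>
     (\<forall>k. \<exists>m>k. \<exists>(a :: nat \<Rightarrow> 'a \<Rightarrow> 'k) (c :: nat \<Rightarrow> real) (v :: nat \<Rightarrow> 'a).
        (\<forall>j. linear_functional E (a j) \<and> v j \<in> vecs E \<and> 0 \<le> c j \<and>
             (\<forall>x\<in>vecs E. norm (a j x) \<le> c j * snorm E m x)) \<and>
        summable (\<lambda>j. c j * snorm E k (v j)) \<and>
        (\<forall>x\<in>vecs E. (\<lambda>n. snorm E k (x - (\<Sum>j<n. scale E (a j x) (v j)))) \<longlonglongrightarrow> 0))"

section \<open>The linear topological invariants\<close>

definition DN_underline ::
  "('k::real_normed_field, 'a::ab_group_add) seminormed_space \<Rightarrow> bool" where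
  "DN_underline E \<longleftrightarrow>
     (\<exists>p. \<forall>k>p. \<exists>n>k. \<exists>\<tau> C. 0 < \<tau> \<and> \<tau> < 1 \<and> 0 < C \<and>
        (\<forall>x\<in>vecs E. snorm E k x \<le> C * snorm E p x powr (1 - \<tau>) * snorm E n x powr \<tau>))"

text \<open>Used for positive exponents only.\<close>

definition ennreal_powr :: "ennreal \<Rightarrow> real \<Rightarrow> ennreal" where
  "ennreal_powr x r = (if x = \<infinity> then \<infinity> else ennreal (enn2real x powr r))"

definition Omega ::
  "('k::real_normed_field, 'a::ab_group_add) seminormed_space \<Rightarrow> bool" where
  "Omega E \<longleftrightarrow>
     (\<forall>p. \<exists>q>p. \<forall>k>q. \<exists>\<theta> C. 0 < \<theta> \<and> \<theta> < 1 \<and> 0 < C \<and>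
        (\<forall>y\<in>dual_space E.
           dual_norm E q y \<le>
             ennreal C * ennreal_powr (dual_norm E p y) (1 - \<theta>) * ennreal_powr (dual_norm E k y) \<theta>))"

section \<open>Kolmogorov diameters and diametral dimensions\<close>

definition kolmogorov_delta ::
  "('k::real_normed_field, 'a::ab_group_add) seminormed_space \<Rightarrow> 'a set \<Rightarrow> 'a set \<Rightarrow> 'a set \<Rightarrow> real" where
  "kolmogorov_delta E V U L =
     Inf {t. 0 < t \<and> V \<subseteq> {scale E (of_real t) u + l | u l. u \<in> U \<and> l \<in> L}}"

text \<open>
  Subspaces of dimension at most \<open>n\<close> are described as spans of at most \<open>n\<close> vectors, since
  \<open>vector_space.dim\<close> is \<open>0\<close> on infinite-dimensional subspaces.
\<close>

definition subspaces_upto ::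
  "('k::real_normed_field, 'a::ab_group_add) seminormed_space \<Rightarrow> nat \<Rightarrow> 'a set set" where
  "subspaces_upto E n = {module.span (scale E) B | B. B \<subseteq> vecs E \<and> finite B \<and> card B \<le> n}"

definition kolmogorov_diameter ::
  "('k::real_normed_field, 'a::ab_group_add) seminormed_space \<Rightarrow> nat \<Rightarrow> 'a set \<Rightarrow> 'a set \<Rightarrow> real" where
  "kolmogorov_diameter E n V U = (INF L\<in>subspaces_upto E n. kolmogorov_delta E V U L)"

definition diametral_dimension ::
  "('k::real_normed_field, 'a::ab_group_add) seminormed_space \<Rightarrow> (nat \<Rightarrow> 'k) set" where
  "diametral_dimension E =
     {t. \<forall>p. \<exists>q>p.
        (\<lambda>n. t n * of_real (kolmogorov_diameter E n (unit_ball E q) (unit_ball E p))) \<longlonglongrightarrow> 0}"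

definition nbhd_zero ::
  "('k::real_normed_field, 'a::ab_group_add) seminormed_space \<Rightarrow> 'a set \<Rightarrow> bool" where
  "nbhd_zero E U \<longleftrightarrow> U \<subseteq> vecs E \<and> (\<exists>k. \<exists>e>0. {x \<in> vecs E. snorm E k x < e} \<subseteq> U)"

definition bounded_subset ::
  "('k::real_normed_field, 'a::ab_group_add) seminormed_space \<Rightarrow> 'a set \<Rightarrow> bool" where
  "bounded_subset E B \<longleftrightarrow> B \<subseteq> vecs E \<and> (\<forall>k. \<exists>C. \<forall>x\<in>B. snorm E k x \<le> C)"

text \<open>
  \<open>t n / d n\<close> tends to \<open>0\<close>, where the quotient counts as infinite if \<open>d n = 0 \<noteq> t n\<close>.  The first
  conjunct is needed because division by zero yields zero in HOL: without it, every sequence would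
  belong to the approximate diametral dimension, via the bounded set \<open>{0}\<close>.
\<close>

definition quotient_null :: "(nat \<Rightarrow> 'k::real_normed_field) \<Rightarrow> (nat \<Rightarrow> real) \<Rightarrow> bool" where
  "quotient_null t d \<longleftrightarrow>
     (\<forall>\<^sub>F n in sequentially. d n = 0 \<longrightarrow> t n = 0) \<and> (\<lambda>n. t n / of_real (d n)) \<longlonglongrightarrow> 0"

text \<open>
  Passing to a smaller absolutely convex neighbourhood of zero, or to the absolutely convex hull of
  a bounded set, never decreases the diameters; so the union below is the same as the one over
  absolutely convex sets only.
\<close>

definition approx_diametral_dimension ::
  "('k::real_normed_field, 'a::ab_group_add) seminormed_space \<Rightarrow> (nat \<Rightarrow> 'k) set" where
  "approx_diametral_dimension E =
     (\<Union>U\<in>Collect (nbhd_zero E). \<Union>B\<in>Collect (bounded_subset E).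
        {t. quotient_null t (\<lambda>n. kolmogorov_diameter E n B U)})"

section \<open>Power series spaces and the associated exponent sequence\<close>

definition exponent_sequence :: "(nat \<Rightarrow> real) \<Rightarrow> bool" where
  "exponent_sequence \<alpha> \<longleftrightarrow> (\<forall>n. 0 \<le> \<alpha> n) \<and> mono \<alpha> \<and> filterlim \<alpha> at_top sequentially"

text \<open>
  Vector addition is the pointwise one.  Seminorms are numbered from \<open>0\<close>, hence \<open>Suc k\<close> in place of
  the positive index \<open>k\<close> in the weights of the finite type space.
\<close>

definition Lambda_1 ::
  "(nat \<Rightarrow> real) \<Rightarrow> ('k::real_normed_field, nat \<Rightarrow> 'k) seminormed_space" where
  "Lambda_1 \<alpha> =
     \<lparr> vecs = {x. \<forall>k. bdd_above (range (\<lambda>n. norm (x n) * exp (- \<alpha> n / real (Suc k))))},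
       scale = (\<lambda>c x n. c * x n),
       snorm = (\<lambda>k x. SUP n. norm (x n) * exp (- \<alpha> n / real (Suc k))) \<rparr>"

definition Lambda_inf ::
  "(nat \<Rightarrow> real) \<Rightarrow> ('k::real_normed_field, nat \<Rightarrow> 'k) seminormed_space" where
  "Lambda_inf \<alpha> =
     \<lparr> vecs = {x. \<forall>k. bdd_above (range (\<lambda>n. norm (x n) * exp (real k * \<alpha> n)))},
       scale = (\<lambda>c x n. c * x n),
       snorm = (\<lambda>k x. SUP n. norm (x n) * exp (real k * \<alpha> n)) \<rparr>"

definition Lambda_inf_dual :: "(nat \<Rightarrow> real) \<Rightarrow> (nat \<Rightarrow> 'k::real_normed_field) set" where
  "Lambda_inf_dual \<alpha> =
     {x. \<exists>R>0. bdd_above (range (\<lambda>n. norm (x n) * exp (- R * \<alpha> n)))}"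

text \<open>
  The competing sequences \<open>\<alpha>\<close> are those whose power series space is nuclear, all power series
  spaces being assumed nuclear.
\<close>

definition associated_exponent_sequence ::
  "('k::real_normed_field, 'a::ab_group_add) seminormed_space \<Rightarrow> (nat \<Rightarrow> real) \<Rightarrow> bool" where
  "associated_exponent_sequence E \<epsilon> \<longleftrightarrow>
     exponent_sequence \<epsilon> \<and>
     diametral_dimension (Lambda_1 \<epsilon> :: ('k, nat \<Rightarrow> 'k) seminormed_space) \<subseteq> diametral_dimension E \<and>
     diametral_dimension E \<subseteq> diametral_dimension (Lambda_inf \<epsilon> :: ('k, nat \<Rightarrow> 'k) seminormed_space) \<and>
     (\<forall>\<alpha>. exponent_sequence \<alpha> \<and> nuclear_space (Lambda_1 \<alpha> :: ('k, nat \<Rightarrow> 'k) seminormed_space) \<and>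
           vecs (Lambda_1 \<alpha> :: ('k, nat \<Rightarrow> 'k) seminormed_space) \<subseteq> diametral_dimension E \<longrightarrow>
           vecs (Lambda_1 \<alpha> :: ('k, nat \<Rightarrow> 'k) seminormed_space) \<subseteq> vecs (Lambda_1 \<epsilon>)) \<and>
     (\<forall>\<alpha>. exponent_sequence \<alpha> \<and> nuclear_space (Lambda_inf \<alpha> :: ('k, nat \<Rightarrow> 'k) seminormed_space) \<and>
           diametral_dimension E \<subseteq> Lambda_inf_dual \<alpha> \<longrightarrow>
           (Lambda_inf_dual \<epsilon> :: (nat \<Rightarrow> 'k) set) \<subseteq> Lambda_inf_dual \<alpha>)"

end

theory Submission
  imports Defs
begin

text \<open>
  Only one inclusion needs a proof, since \<open>\<Delta>(\<Lambda>\<^sub>1(\<epsilon>)) \<subseteq> \<Delta>(E)\<close> is part of what it means for \<open>\<epsilon>\<close> to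
  be associated with \<open>E\<close>.  For the other one, the two dimensions are played off against each other:
  if \<open>t\<close> is in \<open>\<Delta>(E)\<close> and \<open>s\<close> is in \<open>\<delta>(E)\<close>, then \<open>t\<^sub>n s\<^sub>n \<longrightarrow> 0\<close>
  (\<open>diametral_times_approx_diametral_null\<close>).  Indeed, let \<open>s\<^sub>n / d\<^sub>n(B, U) \<longrightarrow> 0\<close> for a bounded set \<open>B\<close>
  and a neighbourhood \<open>U\<close> that contains a multiple of \<open>U\<^sub>p\<close>, and let \<open>q > p\<close> be such that
  \<open>t\<^sub>n d\<^sub>n(U\<^sub>q, U\<^sub>p) \<longrightarrow> 0\<close>.  The bounded set \<open>B\<close> lies in a multiple of \<open>U\<^sub>q\<close>, whatever \<open>q\<close> is, so
  \<open>d\<^sub>n(B, U) \<le> C d\<^sub>n(U\<^sub>q, U\<^sub>p)\<close>, and \<open>t\<^sub>n s\<^sub>n\<close> is at most \<open>C\<close> times the product of the two null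
  sequences.

  The approximate diametral dimension of \<open>\<Lambda>\<^sub>1(\<epsilon>)\<close> contains the sequences \<open>exp (- \<epsilon>\<^sub>n / k)\<close>
  (\<open>exp_in_approx_diametral_dimension_Lambda_1\<close>).  If it equals \<open>\<delta>(E)\<close>, then every \<open>t\<close> in \<open>\<Delta>(E)\<close>
  satisfies \<open>t\<^sub>n exp (- \<epsilon>\<^sub>n / k) \<longrightarrow> 0\<close> for all \<open>k\<close>, and such sequences belong to \<open>\<Delta>(\<Lambda>\<^sub>1(\<epsilon>))\<close>
  (\<open>in_diametral_dimension_Lambda_1\<close>).

  The two facts about \<open>\<Lambda>\<^sub>1(\<epsilon>)\<close> come from estimates of its Kolmogorov diameters.  The upper one
  uses the span of the first \<open>n\<close> unit vectors.  The lower one is a duality argument: a space of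
  dimension at most \<open>n\<close> is annihilated by a nontrivial functional of the first \<open>n + 1\<close> coordinates,
  and comparing the norms of this functional on a unit ball of \<open>\<Lambda>\<^sub>1(\<epsilon>)\<close> and on the bounded set of all
  sequences of modulus at most one shows how much of the ball is required to cover that set up to the space.
\<close>

section \<open>Kolmogorov diameters\<close>

text \<open>
  Absorption keeps the infimum defining \<open>kolmogorov_delta\<close> from ranging over the empty set, where
  its value would be arbitrary.  The constant is recorded because it enters the comparison of
  diameters.
\<close>

definition absorbed_by ::
  "('k::real_normed_field, 'a::ab_group_add) seminormed_space \<Rightarrow> 'a set \<Rightarrow> real \<Rightarrow> 'a set \<Rightarrow> bool" where
  "absorbed_by E V c U \<longleftrightarrow> 0 < c \<and> V \<subseteq> scale E (of_real c) ` U"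

lemma absorbed_by_trans:
  assumes "vector_space (scale E)" "absorbed_by E A c B" "absorbed_by E B d D"
  shows "absorbed_by E A (c * d) D"
proof -
  interpret vector_space "scale E" by fact
  show ?thesis
    using assms(2,3) unfolding absorbed_by_def by (fastforce simp: image_iff subset_iff)
qed

lemma subspaces_upto_subspace:
  assumes "vector_space (scale E)" "L \<in> subspaces_upto E n"
  shows "module.subspace (scale E) L"
proof -
  interpret vector_space "scale E" by fact
  show ?thesis using assms(2) by (auto simp: subspaces_upto_def)
qed

lemma kolmogorov_delta_le:
  assumes "0 < t" "V \<subseteq> {scale E (of_real t) u + l | u l. u \<in> U \<and> l \<in> L}"
  shows "kolmogorov_delta E V U L \<le> t"
  unfolding kolmogorov_delta_def
  by (rule cInf_lower) (use assms in \<open>auto intro!: bdd_belowI[of _ 0]\<close>)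

lemma kolmogorov_delta_ge:
  assumes vs: "vector_space (scale E)" and L: "L \<in> subspaces_upto E n"
    and V: "absorbed_by E V d U"
    and c: "\<And>t. 0 < t \<Longrightarrow> V \<subseteq> {scale E (of_real t) u + l | u l. u \<in> U \<and> l \<in> L} \<Longrightarrow> c \<le> t"
  shows "c \<le> kolmogorov_delta E V U L"
proof -
  interpret vector_space "scale E" by fact
  have "0 \<in> L"
    using subspaces_upto_subspace[OF vs L] by (rule subspace_0)
  then have "V \<subseteq> {scale E (of_real d) u + l | u l. u \<in> U \<and> l \<in> L}"
    using V unfolding absorbed_by_def by (force intro: exI[of _ "0 :: 'a"] simp: image_iff subset_iff)
  then show ?thesis
    unfolding kolmogorov_delta_def
    by (intro cInf_greatest) (use V c in \<open>auto simp: absorbed_by_def\<close>)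
qed

lemma kolmogorov_diameter_ge:
  assumes "vector_space (scale E)" "absorbed_by E V d U"
    and "\<And>L t. L \<in> subspaces_upto E n \<Longrightarrow> 0 < t \<Longrightarrow>
           V \<subseteq> {scale E (of_real t) u + l | u l. u \<in> U \<and> l \<in> L} \<Longrightarrow> c \<le> t"
  shows "c \<le> kolmogorov_diameter E n V U"
proof -
  have "module.span (scale E) {} \<in> subspaces_upto E n"
    unfolding subspaces_upto_def by (intro CollectI exI[of _ "{}"]) auto
  then show ?thesis
    unfolding kolmogorov_diameter_def
    by (intro cINF_greatest) (use assms in \<open>auto intro: kolmogorov_delta_ge\<close>)
qed

lemma kolmogorov_diameter_nonneg:
  assumes "vector_space (scale E)" "absorbed_by E V d U"
  shows "0 \<le> kolmogorov_diameter E n V U"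
  using assms by (rule kolmogorov_diameter_ge) auto

lemma kolmogorov_diameter_le:
  assumes vs: "vector_space (scale E)" and V: "absorbed_by E V d U"
    and L: "L \<in> subspaces_upto E n" and t: "0 < t"
    and sub: "V \<subseteq> {scale E (of_real t) u + l | u l. u \<in> U \<and> l \<in> L}"
  shows "kolmogorov_diameter E n V U \<le> t"
proof -
  have "bdd_below (kolmogorov_delta E V U ` subspaces_upto E n)"
    by (rule bdd_belowI2[of _ 0]) (auto intro: kolmogorov_delta_ge[OF vs _ V])
  then have "kolmogorov_diameter E n V U \<le> kolmogorov_delta E V U L"
    unfolding kolmogorov_diameter_def using L by (rule cINF_lower)
  also have "\<dots> \<le> t"
    using t sub by (rule kolmogorov_delta_le)
  finally show ?thesis .
qed

text \<open>
  Diameters grow with the first set and shrink with the second one, up to the constants of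
  absorption: multiplying \<open>V \<subseteq> tW + L\<close> by \<open>c\<close> does not change the subspace \<open>L\<close>.
\<close>

lemma kolmogorov_diameter_mono:
  assumes vs: "vector_space (scale E)" and BV: "absorbed_by E B c V"
    and VW: "absorbed_by E V a W" and WU: "absorbed_by E W d U"
  shows "kolmogorov_diameter E n B U \<le> (c * d) * kolmogorov_diameter E n V W"
proof -
  interpret vector_space "scale E" by fact
  have pos: "0 < c" "0 < d" using BV WU by (auto simp: absorbed_by_def)
  have BU: "absorbed_by E B (c * a * d) U"
    using absorbed_by_trans[OF vs absorbed_by_trans[OF vs BV VW] WU] .
  have "kolmogorov_diameter E n B U / (c * d) \<le> kolmogorov_diameter E n V W"
  proof (rule kolmogorov_diameter_ge[OF vs VW])
    fix L and t :: real
    assume L: "L \<in> subspaces_upto E n" and t: "0 < t"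
      and sub: "V \<subseteq> {scale E (of_real t) u + l | u l. u \<in> W \<and> l \<in> L}"
    have "B \<subseteq> {scale E (of_real (c * d * t)) u + l | u l. u \<in> U \<and> l \<in> L}"
    proof
      fix x assume "x \<in> B"
      then obtain v where v: "v \<in> V" "x = scale E (of_real c) v"
        using BV by (auto simp: absorbed_by_def)
      obtain w l where w: "v = scale E (of_real t) w + l" "w \<in> W" "l \<in> L"
        using sub v by blast
      obtain u where u: "w = scale E (of_real d) u" "u \<in> U"
        using w WU by (auto simp: absorbed_by_def)
      have "x = scale E (of_real (c * d * t)) u + scale E (of_real c) l"
        by (simp add: v w u scale_right_distrib mult_ac)
      moreover have "scale E (of_real c) l \<in> L"
        using subspace_scale[OF subspaces_upto_subspace[OF vs L]] w by blast
      ultimately show "x \<in> {scale E (of_real (c * d * t)) u + l | u l. u \<in> U \<and> l \<in> L}"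
        using u by blast
    qed
    then have "kolmogorov_diameter E n B U \<le> c * d * t"
      using pos t by (intro kolmogorov_diameter_le[OF vs BU L]) auto
    then show "kolmogorov_diameter E n B U / (c * d) \<le> t"
      using pos by (simp add: field_simps)
  qed
  then show ?thesis using pos by (simp add: field_simps)
qed

section \<open>The two diametral dimensions against each other\<close>

lemma frechet_space_vector_space: "frechet_space E \<Longrightarrow> vector_space (scale E)"
  by (simp add: frechet_space_def)

lemma frechet_space_snorm_scale:
  assumes "frechet_space E" "x \<in> vecs E"
  shows "scale E c x \<in> vecs E" "snorm E k (scale E c x) = norm c * snorm E k x"
proof -
  interpret vector_space "scale E" using assms(1) by (rule frechet_space_vector_space)
  show "scale E c x \<in> vecs E"
    using assms by (auto simp: frechet_space_def intro: subspace_scale)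
  show "snorm E k (scale E c x) = norm c * snorm E k x"
    using assms by (auto simp: frechet_space_def seminorm_on_def)
qed

lemma absorbed_byI_snorm:
  assumes E: "frechet_space E" and "0 < c" and "A \<subseteq> vecs E"
    and U: "\<And>x. x \<in> vecs E \<Longrightarrow> (\<exists>y\<in>A. snorm E k x = snorm E k y / c) \<Longrightarrow> x \<in> U"
  shows "absorbed_by E A c U"
  unfolding absorbed_by_def
proof (intro conjI subsetI)
  interpret vector_space "scale E" using E by (rule frechet_space_vector_space)
  fix x assume x: "x \<in> A"
  then have xE: "x \<in> vecs E" using assms by auto
  have "scale E (of_real (1 / c)) x \<in> U"
  proof (rule U)
    show "scale E (of_real (1 / c)) x \<in> vecs E"
      using frechet_space_snorm_scale(1)[OF E xE] .
    have "snorm E k (scale E (of_real (1 / c)) x) = norm (of_real (1 / c) :: 'a) * snorm E k x"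
      using frechet_space_snorm_scale(2)[OF E xE] .
    also have "\<dots> = snorm E k x / c"
      unfolding norm_of_real using \<open>0 < c\<close> by simp
    finally show "\<exists>y\<in>A. snorm E k (scale E (of_real (1 / c)) x) = snorm E k y / c"
      using x by blast
  qed
  moreover have "x = scale E (of_real c) (scale E (of_real (1 / c)) x)"
    using \<open>0 < c\<close> by (simp flip: of_real_mult)
  ultimately show "x \<in> scale E (of_real c) ` U" by blast
qed (fact)

lemma unit_ball_absorbed_by_unit_ball:
  assumes E: "frechet_space E" and "p \<le> q"
  shows "absorbed_by E (unit_ball E q) 1 (unit_ball E p)"
proof -
  interpret vector_space "scale E" using E by (rule frechet_space_vector_space)
  have "snorm E p x \<le> snorm E q x" if "x \<in> vecs E" for x
    using E that by (intro lift_Suc_mono_le[OF _ \<open>p \<le> q\<close>]) (auto simp: frechet_space_def)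
  then show ?thesis
    by (force simp: absorbed_by_def unit_ball_def)
qed

lemma bounded_subset_absorbed_by_unit_ball:
  assumes E: "frechet_space E" and B: "bounded_subset E B"
  shows "\<exists>c. absorbed_by E B c (unit_ball E q)"
proof -
  obtain C where C: "\<And>x. x \<in> B \<Longrightarrow> snorm E q x \<le> C"
    using B unfolding bounded_subset_def by metis
  have "absorbed_by E B (max C 1) (unit_ball E q)"
  proof (rule absorbed_byI_snorm[OF E])
    show "x \<in> unit_ball E q"
      if "x \<in> vecs E" and y: "\<exists>y\<in>B. snorm E q x = snorm E q y / max C 1" for x
    proof -
      obtain y where "y \<in> B" "snorm E q x = snorm E q y / max C 1" using y by blast
      then show ?thesis using that C[of y] by (simp add: unit_ball_def)
    qed
  qed (use B in \<open>auto simp: bounded_subset_def\<close>)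
  then show ?thesis ..
qed

lemma unit_ball_absorbed_by_nbhd:
  assumes E: "frechet_space E" and U: "nbhd_zero E U"
  shows "\<exists>p d. absorbed_by E (unit_ball E p) d U"
proof -
  obtain p e where e: "0 < e" "{x \<in> vecs E. snorm E p x < e} \<subseteq> U"
    using U unfolding nbhd_zero_def by blast
  have "absorbed_by E (unit_ball E p) (2 / e) U"
  proof (rule absorbed_byI_snorm[OF E])
    show "x \<in> U"
      if x: "x \<in> vecs E" and y: "\<exists>y\<in>unit_ball E p. snorm E p x = snorm E p y / (2 / e)" for x
    proof -
      obtain y where y: "snorm E p y \<le> 1" "snorm E p x = snorm E p y / (2 / e)"
        using y by (auto simp: unit_ball_def)
      have "snorm E p x \<le> e / 2"
        using y e mult_right_mono[of "snorm E p y" 1 e] by simp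
      then have "snorm E p x < e" using e by linarith
      then show ?thesis using e x by auto
    qed
  qed (use e in \<open>auto simp: unit_ball_def\<close>)
  then show ?thesis by blast
qed

text \<open>
  The neighbourhood for \<open>s\<close> fixes the index \<open>p\<close>, and only then does \<open>t\<close> choose \<open>q\<close>.  This order of
  the quantifiers is harmless because a bounded set is absorbed by all unit balls.
\<close>

lemma diametral_times_approx_diametral_null:
  fixes E :: "('k::real_normed_field, 'a::ab_group_add) seminormed_space"
  assumes E: "frechet_space E"
    and t: "t \<in> diametral_dimension E" and s: "s \<in> approx_diametral_dimension E"
  shows "(\<lambda>n. t n * s n) \<longlonglongrightarrow> 0"
proof -
  have vs: "vector_space (scale E)" using E by (rule frechet_space_vector_space)
  obtain U B where U: "nbhd_zero E U" and B: "bounded_subset E B"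
    and quot: "quotient_null s (\<lambda>n. kolmogorov_diameter E n B U)"
    using s by (auto simp: approx_diametral_dimension_def)
  define d where "d n = kolmogorov_diameter E n B U" for n
  obtain p b where pU: "absorbed_by E (unit_ball E p) b U"
    using unit_ball_absorbed_by_nbhd[OF E U] by blast
  obtain q where q: "p < q"
    and tq: "(\<lambda>n. t n * of_real (kolmogorov_diameter E n (unit_ball E q) (unit_ball E p))) \<longlonglongrightarrow> 0"
    using t by (auto simp: diametral_dimension_def)
  define D where "D n = kolmogorov_diameter E n (unit_ball E q) (unit_ball E p)" for n
  have tD: "(\<lambda>n. t n * of_real (D n)) \<longlonglongrightarrow> 0" using tq by (simp add: D_def)
  obtain c where Bq: "absorbed_by E B c (unit_ball E q)"
    using bounded_subset_absorbed_by_unit_ball[OF E B] by blast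
  have qp: "absorbed_by E (unit_ball E q) 1 (unit_ball E p)"
    using unit_ball_absorbed_by_unit_ball[OF E] q by simp
  have dD: "d n \<le> (c * b) * D n" for n
    unfolding d_def D_def by (rule kolmogorov_diameter_mono[OF vs Bq qp pU])
  have d0: "0 \<le> d n" for n
    unfolding d_def
    by (rule kolmogorov_diameter_nonneg[OF vs absorbed_by_trans[OF vs absorbed_by_trans[OF vs Bq qp] pU]])
  have D0: "0 \<le> D n" for n
    unfolding D_def by (rule kolmogorov_diameter_nonneg[OF vs qp])
  have lim: "(\<lambda>n. t n * of_real (D n) * (s n / of_real (d n))) \<longlonglongrightarrow> 0"
    using quot by (intro tendsto_mult_zero tD) (simp add: quotient_null_def d_def)
  have "\<forall>\<^sub>F n in sequentially. d n = 0 \<longrightarrow> s n = 0"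
    using quot by (simp add: quotient_null_def d_def)
  then have "\<forall>\<^sub>F n in sequentially.
      norm (t n * s n) \<le> norm (t n * of_real (D n) * (s n / of_real (d n))) * (c * b)"
  proof eventually_elim
    case (elim n)
    show ?case
    proof (cases "d n = 0")
      case True
      then show ?thesis using elim by simp
    next
      case False
      have "norm (t n * s n) = norm (t n) * d n * norm (s n / of_real (d n))"
        using False d0[of n] by (simp add: norm_mult norm_divide)
      also have "\<dots> \<le> norm (t n) * ((c * b) * D n) * norm (s n / of_real (d n))"
        by (intro mult_right_mono mult_left_mono dD) auto
      also have "\<dots> = norm (t n * of_real (D n) * (s n / of_real (d n))) * (c * b)"
        using D0[of n] by (simp add: norm_mult norm_divide)
      finally show ?thesis .
    qed
  qed
  with lim show ?thesis by (rule tendsto_0_le)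
qed

section \<open>Power series spaces of finite type\<close>

lemma vector_space_Lambda_1:
  "vector_space (scale (Lambda_1 \<alpha> :: ('k::real_normed_field, nat \<Rightarrow> 'k) seminormed_space))"
  by unfold_locales (auto simp: Lambda_1_def fun_eq_iff algebra_simps)

lemma Lambda_1_snorm_leI:
  fixes x :: "nat \<Rightarrow> 'k::real_normed_field"
  assumes "\<And>n. norm (x n) \<le> C * exp (\<alpha> n / real (Suc k))"
  shows "snorm (Lambda_1 \<alpha>) k x \<le> C"
proof -
  have "norm (x n) * exp (- \<alpha> n / real (Suc k)) \<le> C" for n
    using assms[of n] by (simp add: exp_minus field_simps)
  then show ?thesis unfolding Lambda_1_def by (auto intro: cSUP_least)
qed

lemma Lambda_1_norm_le:
  fixes x :: "nat \<Rightarrow> 'k::real_normed_field"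
  assumes "x \<in> unit_ball (Lambda_1 \<alpha>) k"
  shows "norm (x n) \<le> exp (\<alpha> n / real (Suc k))"
proof -
  have bdd: "bdd_above (range (\<lambda>n. norm (x n) * exp (- \<alpha> n / real (Suc k))))"
    and le: "(SUP n. norm (x n) * exp (- \<alpha> n / real (Suc k))) \<le> 1"
    using assms by (auto simp: unit_ball_def Lambda_1_def)
  have "norm (x n) * exp (- \<alpha> n / real (Suc k)) \<le> 1"
    using cSUP_upper[OF UNIV_I bdd, of n] le by linarith
  then show ?thesis by (simp add: exp_minus field_simps)
qed

lemma Lambda_1_vecsI_bound:
  fixes x y :: "nat \<Rightarrow> 'k::real_normed_field"
  assumes "y \<in> vecs (Lambda_1 \<alpha>)" and le: "\<And>n. norm (x n) \<le> C * norm (y n)"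
  shows "x \<in> vecs (Lambda_1 \<alpha>)"
proof -
  have "bdd_above (range (\<lambda>n. norm (x n) * exp (- \<alpha> n / real (Suc k))))" for k
  proof -
    have "bdd_above (range (\<lambda>n. norm (y n) * exp (- \<alpha> n / real (Suc k))))"
      using assms(1) by (simp add: Lambda_1_def)
    then obtain M where M: "\<And>n. norm (y n) * exp (- \<alpha> n / real (Suc k)) \<le> M"
      by (auto simp: bdd_above_def)
    have "norm (x n) * exp (- \<alpha> n / real (Suc k)) \<le> \<bar>C\<bar> * M" for n
    proof -
      have "norm (x n) \<le> \<bar>C\<bar> * norm (y n)"
        using le[of n] mult_right_mono[OF abs_ge_self[of C] norm_ge_zero[of "y n"]] by linarith
      then have "norm (x n) * exp (- \<alpha> n / real (Suc k))
          \<le> \<bar>C\<bar> * norm (y n) * exp (- \<alpha> n / real (Suc k))"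
        by (rule mult_right_mono) simp
      also have "\<dots> \<le> \<bar>C\<bar> * M"
        unfolding mult.assoc by (intro mult_left_mono M) simp
      finally show ?thesis .
    qed
    then show ?thesis by (auto simp: bdd_above_def)
  qed
  then show ?thesis by (simp add: Lambda_1_def)
qed

lemma Lambda_1_vecsI_le_1:
  fixes x :: "nat \<Rightarrow> 'k::real_normed_field"
  assumes "exponent_sequence \<alpha>" "\<And>n. norm (x n) \<le> 1"
  shows "x \<in> vecs (Lambda_1 \<alpha>)"
proof (rule Lambda_1_vecsI_bound)
  have "norm (1 :: 'k) * exp (- \<alpha> n / real (Suc k)) \<le> 1" for n k
    using assms(1) by (simp add: exponent_sequence_def del: of_nat_Suc)
  then have "bdd_above (range (\<lambda>n. norm (1 :: 'k) * exp (- \<alpha> n / real (Suc k))))" for k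
    by (rule bdd_aboveI2)
  then show "(\<lambda>_. 1 :: 'k) \<in> vecs (Lambda_1 \<alpha>)"
    by (simp add: Lambda_1_def)
qed (use assms(2) in \<open>auto intro: order_trans[of _ 1 "1 * 1"]\<close>)

subsection \<open>Upper bound for the diameters\<close>

lemma Lambda_1_unit_ball_absorbed:
  assumes \<alpha>: "exponent_sequence \<alpha>"
  shows "absorbed_by (Lambda_1 \<alpha> :: ('k::real_normed_field, nat \<Rightarrow> 'k) seminormed_space)
    (unit_ball (Lambda_1 \<alpha>) (Suc p)) 1 (unit_ball (Lambda_1 \<alpha>) p)"
proof -
  have "x \<in> unit_ball (Lambda_1 \<alpha>) p"
    if x: "x \<in> unit_ball (Lambda_1 \<alpha>) (Suc p)" for x :: "nat \<Rightarrow> 'k"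
  proof -
    have "norm (x n) \<le> 1 * exp (\<alpha> n / real (Suc p))" for n
    proof -
      have "\<alpha> n / real (Suc (Suc p)) \<le> \<alpha> n / real (Suc p)"
        using \<alpha> by (intro divide_left_mono) (auto simp: exponent_sequence_def)
      then have "exp (\<alpha> n / real (Suc (Suc p))) \<le> exp (\<alpha> n / real (Suc p))" by simp
      then show ?thesis using Lambda_1_norm_le[OF x, of n] by linarith
    qed
    then have "snorm (Lambda_1 \<alpha>) p x \<le> 1" by (rule Lambda_1_snorm_leI)
    then show ?thesis using x by (simp add: unit_ball_def)
  qed
  then show ?thesis
    by (auto simp: absorbed_by_def image_iff Lambda_1_def)
qed

text \<open>
  The approximating subspace consists of the sequences supported in \<open>{..<n}\<close>.  What remains of an
  element of \<open>U\<^sub>p\<^sub>+\<^sub>1\<close> is supported where \<open>\<alpha> i \<ge> \<alpha> n\<close>, so that the passage to the smaller weights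
  of \<open>U\<^sub>p\<close> gains the factor \<open>exp (- \<alpha> n (1/(p+1) - 1/(p+2)))\<close>.
\<close>

lemma Lambda_1_diameter_le:
  assumes \<alpha>: "exponent_sequence \<alpha>"
  shows "kolmogorov_diameter (Lambda_1 \<alpha> :: ('k::real_normed_field, nat \<Rightarrow> 'k) seminormed_space) n
           (unit_ball (Lambda_1 \<alpha>) (Suc p)) (unit_ball (Lambda_1 \<alpha>) p)
         \<le> exp (- \<alpha> n * (1 / real (Suc p) - 1 / real (Suc (Suc p))))"
    (is "?d \<le> exp (- \<alpha> n * ?a)")
proof -
  let ?E = "Lambda_1 \<alpha> :: ('k, nat \<Rightarrow> 'k) seminormed_space"
  interpret vector_space "scale ?E" by (rule vector_space_Lambda_1)
  define e where "e i = (\<lambda>j. if j = i then 1 else 0 :: 'k)" for i :: nat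
  have "0 < ?a" by (simp add: frac_less2)
  have "e i \<in> vecs ?E" for i
    using \<alpha> by (rule Lambda_1_vecsI_le_1) (simp add: e_def)
  moreover have "card (e ` {..<n}) \<le> n"
    using card_image_le[of "{..<n}" e] by simp
  ultimately have L: "span (e ` {..<n}) \<in> subspaces_upto ?E n"
    unfolding subspaces_upto_def by blast
  have cut: "(\<Sum>i<m. scale ?E (x i) (e i)) = (\<lambda>j. if j < m then x j else 0)" for x and m :: nat
    by (induction m) (auto simp: fun_eq_iff Lambda_1_def e_def less_Suc_eq)
  show ?thesis
  proof (rule kolmogorov_diameter_le[OF vector_space_axioms Lambda_1_unit_ball_absorbed[OF \<alpha>] L])
    show "unit_ball ?E (Suc p) \<subseteq>
      {scale ?E (of_real (exp (- \<alpha> n * ?a))) u + l | u l. u \<in> unit_ball ?E p \<and> l \<in> span (e ` {..<n})}"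
    proof
      fix x assume x: "x \<in> unit_ball ?E (Suc p)"
      define l where "l = (\<lambda>j. if j < n then x j else 0)"
      define u where "u = (\<lambda>j. if j < n then 0 else of_real (exp (\<alpha> n * ?a)) * x j)"
      have "l \<in> span (e ` {..<n})"
        unfolding l_def cut[symmetric] by (intro span_sum span_scale span_base) auto
      moreover have "u \<in> unit_ball ?E p"
      proof -
        have "x \<in> vecs ?E" using x by (simp add: unit_ball_def)
        then have "u \<in> vecs ?E"
          by (rule Lambda_1_vecsI_bound[where C = "exp (\<alpha> n * ?a)"]) (simp add: u_def norm_mult)
        moreover have "norm (u j) \<le> 1 * exp (\<alpha> j / real (Suc p))" for j
        proof (cases "j < n")
          case False
          then have "\<alpha> n * ?a \<le> \<alpha> j * ?a"
            using \<alpha> \<open>0 < ?a\<close> by (intro mult_right_mono) (auto simp: exponent_sequence_def mono_def)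
          then have exponents: "\<alpha> n * ?a + \<alpha> j / real (Suc (Suc p)) \<le> \<alpha> j / real (Suc p)"
            by (simp add: right_diff_distrib)
          have "norm (u j) = exp (\<alpha> n * ?a) * norm (x j)"
            using False by (simp add: u_def norm_mult)
          also have "\<dots> \<le> exp (\<alpha> n * ?a) * exp (\<alpha> j / real (Suc (Suc p)))"
            by (intro mult_left_mono Lambda_1_norm_le x) simp
          also have "\<dots> \<le> exp (\<alpha> j / real (Suc p))"
            using exponents by (simp flip: exp_add)
          finally show ?thesis by simp
        qed (simp add: u_def)
        then have "snorm ?E p u \<le> 1" by (rule Lambda_1_snorm_leI)
        ultimately show ?thesis by (simp add: unit_ball_def)
      qed
      moreover have "x = scale ?E (of_real (exp (- \<alpha> n * ?a))) u + l"
      proof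
        fix j
        have "of_real (exp (- \<alpha> n * ?a)) * (of_real (exp (\<alpha> n * ?a)) * x j) = x j"
          by (simp flip: mult.assoc of_real_mult exp_add)
        then show "x j = (scale ?E (of_real (exp (- \<alpha> n * ?a))) u + l) j"
          by (simp add: Lambda_1_def u_def l_def)
      qed
      ultimately show "x \<in> {scale ?E (of_real (exp (- \<alpha> n * ?a))) u + l | u l.
          u \<in> unit_ball ?E p \<and> l \<in> span (e ` {..<n})}" by blast
    qed
  qed simp
qed

lemma in_diametral_dimension_Lambda_1:
  fixes t :: "nat \<Rightarrow> 'k::real_normed_field"
  assumes \<alpha>: "exponent_sequence \<alpha>"
    and t: "\<And>k. (\<lambda>n. t n * of_real (exp (- \<alpha> n / real (Suc k)))) \<longlonglongrightarrow> 0"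
  shows "t \<in> diametral_dimension (Lambda_1 \<alpha> :: ('k, nat \<Rightarrow> 'k) seminormed_space)"
proof -
  let ?E = "Lambda_1 \<alpha> :: ('k, nat \<Rightarrow> 'k) seminormed_space"
  have "(\<lambda>n. t n * of_real (kolmogorov_diameter ?E n (unit_ball ?E (Suc p)) (unit_ball ?E p)))
          \<longlonglongrightarrow> 0" for p
  proof -
    define k where "k = Suc p * Suc (Suc p) - 1"
    have "1 / real (Suc p) - 1 / real (Suc (Suc p)) = 1 / (real (Suc p) * real (Suc (Suc p)))"
      by (simp add: divide_simps)
    also have "\<dots> = 1 / real (Suc k)"
      unfolding k_def by (simp only: of_nat_mult[symmetric]) simp
    finally have k: "1 / real (Suc p) - 1 / real (Suc (Suc p)) = 1 / real (Suc k)" .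
    have nonneg: "0 \<le> kolmogorov_diameter ?E n (unit_ball ?E (Suc p)) (unit_ball ?E p)" for n
      by (rule kolmogorov_diameter_nonneg[OF vector_space_Lambda_1 Lambda_1_unit_ball_absorbed[OF \<alpha>]])
    have "norm (t n * of_real (kolmogorov_diameter ?E n (unit_ball ?E (Suc p)) (unit_ball ?E p)))
        \<le> norm (t n * of_real (exp (- \<alpha> n / real (Suc k)))) * 1" for n
      using Lambda_1_diameter_le[OF \<alpha>, of n p, where 'k = 'k] nonneg[of n]
      unfolding k by (auto simp: norm_mult intro: mult_left_mono)
    then show ?thesis
      by (intro tendsto_0_le[OF t[of k] always_eventually]) blast
  qed
  then show ?thesis
    unfolding diametral_dimension_def by blast
qed

subsection \<open>Lower bound for the diameters\<close>

text \<open>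
  Gaussian elimination: each step removes one equation together with an unknown that occurs in it,
  so that unknowns remain in excess.
\<close>

lemma nontrivial_solution:
  fixes f :: "'b \<Rightarrow> 'i \<Rightarrow> 'f::field"
  assumes "finite J" "finite I" "card J < card I"
  shows "\<exists>c. (\<exists>i\<in>I. c i \<noteq> 0) \<and> (\<forall>j\<in>J. (\<Sum>i\<in>I. c i * f j i) = 0)"
  using assms
proof (induction J arbitrary: I f rule: finite_induct)
  case empty
  then have "I \<noteq> {}" by auto
  then show ?case by (intro exI[of _ "\<lambda>_. 1"]) auto
next
  case (insert j J)
  show ?case
  proof (cases "\<forall>i\<in>I. f j i = 0")
    case True
    obtain c where "\<exists>i\<in>I. c i \<noteq> 0" "\<forall>j\<in>J. (\<Sum>i\<in>I. c i * f j i) = 0"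
      using insert.IH[of I f] insert.prems insert.hyps by auto
    then show ?thesis using True by (intro exI[of _ c]) simp
  next
    case False
    then obtain h where h: "h \<in> I" "f j h \<noteq> 0" by blast
    define I' where "I' = I - {h}"
    have I': "finite I'" "h \<notin> I'" "I = insert h I'" "card J < card I'"
      using insert.prems insert.hyps h by (auto simp: I'_def)
    obtain c where c: "\<exists>i\<in>I'. c i \<noteq> 0"
      "\<forall>m\<in>J. (\<Sum>i\<in>I'. c i * (f m i - f m h / f j h * f j i)) = 0"
      using insert.IH[of I' "\<lambda>m i. f m i - f m h / f j h * f j i"] I' by blast
    define S where "S = (\<Sum>i\<in>I'. c i * f j i)"
    define c' where "c' = c(h := - S / f j h)"
    have c'_sum: "(\<Sum>i\<in>I. c' i * f m i) = - S / f j h * f m h + (\<Sum>i\<in>I'. c i * f m i)" for m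
    proof -
      have "(\<Sum>i\<in>I'. c' i * f m i) = (\<Sum>i\<in>I'. c i * f m i)"
        by (rule sum.cong) (use I'(2) in \<open>auto simp: c'_def\<close>)
      then show ?thesis using I' by (simp add: c'_def)
    qed
    have "(\<Sum>i\<in>I. c' i * f m i) = 0" if "m \<in> J" for m
    proof -
      have "(\<Sum>i\<in>I'. c i * (f m i - f m h / f j h * f j i))
          = (\<Sum>i\<in>I'. c i * f m i) - f m h / f j h * S"
        by (simp add: S_def sum_subtractf sum_distrib_left algebra_simps)
      then show ?thesis using c(2) that by (simp add: c'_sum)
    qed
    moreover have "(\<Sum>i\<in>I. c' i * f j i) = 0"
      using h by (simp add: c'_sum S_def)
    moreover have "\<exists>i\<in>I. c' i \<noteq> 0"
      using c(1) I' by (auto simp: c'_def)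
    ultimately show ?thesis by blast
  qed
qed

lemma Lambda_1_unit_cube_absorbed:
  assumes \<alpha>: "exponent_sequence \<alpha>"
  shows "absorbed_by (Lambda_1 \<alpha> :: ('k::real_normed_field, nat \<Rightarrow> 'k) seminormed_space)
    {x. \<forall>n. norm (x n) \<le> 1} 1 (unit_ball (Lambda_1 \<alpha>) p)"
proof -
  have "x \<in> unit_ball (Lambda_1 \<alpha>) p" if x: "\<And>n. norm (x n) \<le> 1" for x :: "nat \<Rightarrow> 'k"
  proof -
    have "norm (x n) \<le> 1 * exp (\<alpha> n / real (Suc p))" for n
      using x[of n] \<alpha> by (auto simp: exponent_sequence_def intro: order_trans)
    then have "snorm (Lambda_1 \<alpha>) p x \<le> 1" by (rule Lambda_1_snorm_leI)
    then show ?thesis using Lambda_1_vecsI_le_1[OF \<alpha> x] by (simp add: unit_ball_def)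
  qed
  then show ?thesis by (auto simp: absorbed_by_def image_iff Lambda_1_def)
qed

text \<open>
  Let \<open>c\<close> be the coefficients of a nontrivial functional of the coordinates \<open>0, \<dots>, n\<close> that vanishes
  on the approximating subspace.  It takes the value \<open>\<Sum> \<bar>c i\<bar>\<close> at a sequence of modulus at most one,
  whereas on \<open>U\<^sub>p\<close> it is bounded by \<open>\<Sum> \<bar>c i\<bar> exp (\<alpha> i / (p+1)) \<le> exp (\<alpha> n / (p+1)) \<Sum> \<bar>c i\<bar>\<close>.
\<close>

lemma Lambda_1_diameter_ge:
  assumes \<alpha>: "exponent_sequence \<alpha>"
  shows "exp (- \<alpha> n / real (Suc p)) \<le>
    kolmogorov_diameter (Lambda_1 \<alpha> :: ('k::real_normed_field, nat \<Rightarrow> 'k) seminormed_space) n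
      {x. \<forall>n. norm (x n) \<le> 1} (unit_ball (Lambda_1 \<alpha>) p)"
proof (rule kolmogorov_diameter_ge[OF vector_space_Lambda_1 Lambda_1_unit_cube_absorbed[OF \<alpha>]])
  let ?E = "Lambda_1 \<alpha> :: ('k, nat \<Rightarrow> 'k) seminormed_space"
  interpret vector_space "scale ?E" by (rule vector_space_Lambda_1)
  fix L and t :: real
  assume "L \<in> subspaces_upto ?E n" and t: "0 < t"
    and sub: "{x. \<forall>n. norm (x n) \<le> 1}
      \<subseteq> {scale ?E (of_real t) u + l | u l. u \<in> unit_ball ?E p \<and> l \<in> L}"
  then obtain B where B: "finite B" "card B \<le> n" "L = span B"
    by (auto simp: subspaces_upto_def)
  obtain c where c: "\<exists>i\<in>{..n}. c i \<noteq> 0" "\<And>b. b \<in> B \<Longrightarrow> (\<Sum>i\<le>n. c i * b i) = 0"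
    using nontrivial_solution[of B "{..n}" "\<lambda>b i. b i"] B by auto
  have annihilates: "(\<Sum>i\<le>n. c i * l i) = 0" if "l \<in> L" for l
    using that unfolding B
  proof (induction rule: span_induct_alt)
    case base
    then show ?case by simp
  next
    case (step a x y)
    have "(\<Sum>i\<le>n. c i * (scale ?E a x + y) i) = a * (\<Sum>i\<le>n. c i * x i) + (\<Sum>i\<le>n. c i * y i)"
      by (simp add: Lambda_1_def sum_distrib_left sum.distrib algebra_simps)
    then show ?case using step c by simp
  qed
  \<comment> \<open>The moduli are at most one, and zero where \<open>c i = 0\<close>, as division by zero yields zero.\<close>
  define x where "x = (\<lambda>i. of_real (norm (c i)) / c i)"
  define S where "S = (\<Sum>i\<le>n. norm (c i))"
  have "0 < S"
  proof -
    obtain i where "i \<in> {..n}" "c i \<noteq> 0" using c(1) by blast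
    then show ?thesis unfolding S_def by (intro sum_pos2[of _ i]) auto
  qed
  have "norm (x i) \<le> 1" for i
    by (simp add: x_def norm_divide)
  then obtain u l where u: "u \<in> unit_ball ?E p" and l: "l \<in> L" and x: "x = scale ?E (of_real t) u + l"
    using sub by blast
  have "of_real S = (\<Sum>i\<le>n. c i * x i)"
    unfolding S_def of_real_sum by (rule sum.cong) (auto simp: x_def)
  also have "\<dots> = of_real t * (\<Sum>i\<le>n. c i * u i) + (\<Sum>i\<le>n. c i * l i)"
    unfolding x by (simp add: Lambda_1_def sum_distrib_left sum.distrib algebra_simps)
  finally have "(of_real S :: 'k) = of_real t * (\<Sum>i\<le>n. c i * u i)"
    using annihilates[OF l] by simp
  then have "norm (of_real S :: 'k) = t * norm (\<Sum>i\<le>n. c i * u i)"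
    using t by (simp add: norm_mult)
  then have "S = t * norm (\<Sum>i\<le>n. c i * u i)"
    using \<open>0 < S\<close> by simp
  also have "norm (\<Sum>i\<le>n. c i * u i) \<le> (\<Sum>i\<le>n. norm (c i) * exp (\<alpha> n / real (Suc p)))"
  proof (rule sum_norm_le)
    fix i assume "i \<in> {..n}"
    then have "exp (\<alpha> i / real (Suc p)) \<le> exp (\<alpha> n / real (Suc p))"
      using \<alpha> by (auto simp: exponent_sequence_def mono_def intro!: divide_right_mono)
    then have "norm (u i) \<le> exp (\<alpha> n / real (Suc p))"
      using Lambda_1_norm_le[OF u, of i] by linarith
    then show "norm (c i * u i) \<le> norm (c i) * exp (\<alpha> n / real (Suc p))"
      by (simp add: norm_mult mult_left_mono)
  qed
  also have "\<dots> = S * exp (\<alpha> n / real (Suc p))"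
    by (simp add: S_def sum_distrib_right)
  finally have "S * 1 \<le> S * (t * exp (\<alpha> n / real (Suc p)))"
    using t by (simp add: mult_ac)
  then have "1 \<le> t * exp (\<alpha> n / real (Suc p))"
    using \<open>0 < S\<close> by (simp only: mult_le_cancel_left_pos)
  then show "exp (- \<alpha> n / real (Suc p)) \<le> t"
    by (simp add: exp_minus field_simps)
qed

text \<open>
  The neighbourhood is the unit ball of index \<open>k + 1\<close>, one more than that of the given weight: with
  respect to it, the diameters of the unit cube are at least \<open>exp (- \<alpha> n / (k+2))\<close>, which tends to
  zero more slowly than \<open>exp (- \<alpha> n / (k+1))\<close>.
\<close>

lemma exp_in_approx_diametral_dimension_Lambda_1:
  assumes \<alpha>: "exponent_sequence \<alpha>"
  shows "(\<lambda>n. of_real (exp (- \<alpha> n / real (Suc k))))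
    \<in> approx_diametral_dimension (Lambda_1 \<alpha> :: ('k::real_normed_field, nat \<Rightarrow> 'k) seminormed_space)"
proof -
  let ?E = "Lambda_1 \<alpha> :: ('k, nat \<Rightarrow> 'k) seminormed_space"
  let ?B = "{x :: nat \<Rightarrow> 'k. \<forall>n. norm (x n) \<le> 1}"
  define d where "d n = kolmogorov_diameter ?E n ?B (unit_ball ?E (Suc k))" for n
  have d: "exp (- \<alpha> n / real (Suc (Suc k))) \<le> d n" for n
    unfolding d_def by (rule Lambda_1_diameter_ge[OF \<alpha>])
  have d_pos: "0 < d n" for n
    using d[of n] by (rule less_le_trans[rotated]) simp
  have "nbhd_zero ?E (unit_ball ?E (Suc k))"
    unfolding nbhd_zero_def unit_ball_def by (intro conjI exI[of _ "Suc k"] exI[of _ 1]) auto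
  moreover have "bounded_subset ?E ?B"
    unfolding bounded_subset_def
  proof (intro conjI allI)
    show "?B \<subseteq> vecs ?E" using Lambda_1_vecsI_le_1[OF \<alpha>] by blast
    have "?B \<subseteq> unit_ball ?E m" for m
      using Lambda_1_unit_cube_absorbed[OF \<alpha>, of m, where 'k = 'k]
      by (auto simp: absorbed_by_def image_iff Lambda_1_def subset_iff)
    then show "\<exists>C. \<forall>x\<in>?B. snorm ?E m x \<le> C" for m
      by (intro exI[of _ 1]) (auto simp: unit_ball_def)
  qed
  moreover have "quotient_null (\<lambda>n. of_real (exp (- \<alpha> n / real (Suc k))) :: 'k) d"
    unfolding quotient_null_def
  proof
    show "\<forall>\<^sub>F n in sequentially. d n = 0 \<longrightarrow> (of_real (exp (- \<alpha> n / real (Suc k))) :: 'k) = 0"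
      using d_pos by (intro always_eventually) (metis less_irrefl)
    let ?a = "1 / real (Suc k) - 1 / real (Suc (Suc k))"
    have "0 < ?a" by (simp add: frac_less2)
    then have "filterlim (\<lambda>n. ?a * \<alpha> n) at_top sequentially"
      using \<alpha> by (intro filterlim_tendsto_pos_mult_at_top[OF tendsto_const])
        (auto simp: exponent_sequence_def)
    then have lim: "(\<lambda>n. exp (- (?a * \<alpha> n))) \<longlonglongrightarrow> 0"
      by (intro filterlim_compose[OF exp_at_bot]) (simp add: filterlim_uminus_at_bot)
    have "norm (of_real (exp (- \<alpha> n / real (Suc k))) / of_real (d n) :: 'k) \<le> norm (exp (- (?a * \<alpha> n))) * 1" for n
    proof -
      have "norm (of_real (exp (- \<alpha> n / real (Suc k))) / of_real (d n) :: 'k)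
          = exp (- \<alpha> n / real (Suc k)) / d n"
        using d_pos[of n] by (simp add: norm_divide)
      also have "\<dots> \<le> exp (- \<alpha> n / real (Suc k)) / exp (- \<alpha> n / real (Suc (Suc k)))"
        using d[of n] d_pos[of n] by (intro divide_left_mono) auto
      also have "\<dots> = exp (- (?a * \<alpha> n))"
        unfolding exp_diff[symmetric] by (simp add: left_diff_distrib)
      finally show ?thesis by simp
    qed
    then show "(\<lambda>n. of_real (exp (- \<alpha> n / real (Suc k))) / of_real (d n) :: 'k) \<longlonglongrightarrow> 0"
      by (intro tendsto_0_le[OF lim always_eventually]) blast
  qed
  ultimately show ?thesis
    unfolding approx_diametral_dimension_def d_def by blast
qed

section \<open>Equality of the diametral dimensions\<close>

theorem proposition4p1:
  fixes E :: "('k::real_normed_field, 'a::ab_group_add) seminormed_space"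
    and \<epsilon> :: "nat \<Rightarrow> real"
  assumes "frechet_space E"
    and "\<And>k. hilbertian_on E (snorm E k)"
    and "nuclear_space E"
    and "DN_underline E"
    and "Omega E"
    and "associated_exponent_sequence E \<epsilon>"
    and "nuclear_space (Lambda_1 \<epsilon> :: ('k, nat \<Rightarrow> 'k) seminormed_space)"
    and "approx_diametral_dimension E =
         approx_diametral_dimension (Lambda_1 \<epsilon> :: ('k, nat \<Rightarrow> 'k) seminormed_space)"
  shows "diametral_dimension E =
         diametral_dimension (Lambda_1 \<epsilon> :: ('k, nat \<Rightarrow> 'k) seminormed_space)"
proof
  have \<epsilon>: "exponent_sequence \<epsilon>"
    and sub: "diametral_dimension (Lambda_1 \<epsilon> :: ('k, nat \<Rightarrow> 'k) seminormed_space)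
      \<subseteq> diametral_dimension E"
    using assms(6) by (simp_all add: associated_exponent_sequence_def)
  show "diametral_dimension E
      \<subseteq> diametral_dimension (Lambda_1 \<epsilon> :: ('k, nat \<Rightarrow> 'k) seminormed_space)"
  proof
    fix t assume t: "t \<in> diametral_dimension E"
    show "t \<in> diametral_dimension (Lambda_1 \<epsilon> :: ('k, nat \<Rightarrow> 'k) seminormed_space)"
    proof (rule in_diametral_dimension_Lambda_1[OF \<epsilon>])
      fix k
      have "(\<lambda>n. of_real (exp (- \<epsilon> n / real (Suc k)))) \<in> approx_diametral_dimension E"
        unfolding assms(8) by (rule exp_in_approx_diametral_dimension_Lambda_1[OF \<epsilon>])
      then show "(\<lambda>n. t n * of_real (exp (- \<epsilon> n / real (Suc k)))) \<longlonglongrightarrow> 0"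
        by (rule diametral_times_approx_diametral_null[OF assms(1) t])
    qed
  qed
  show "diametral_dimension (Lambda_1 \<epsilon> :: ('k, nat \<Rightarrow> 'k) seminormed_space)
      \<subseteq> diametral_dimension E"
    by (rule sub)
qed

end
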